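(* Let $c=1$, let $a>1$ be an integer and let $L_h\ge 1$ be an integer. There exists a binary matrix $\mathbf{H}_s$ with $a$ rows and $L_h$ columns, each row containing exactly $w=2$ ones, such that the Tanner graph of the semi-infinite parity-check matrix $\mathbf{H}$ obtained from $\mathbf{H}_s$ with shift $c=1$ contains no local cycle of length less than $8$, if and only if $$L_h\ge 2a.$$
   Context: Syndrome former matrix and parity-check matrix: given integers $a>c\ge1$ and a binary $a\times L_h$ matrix $\mathbf{H}_s$ (the syndrome former matrix; rows indexed $0,\ldots,a-1$, columns indexed $0,\ldots,L_h-1$), the semi-infinite binary parity-check matrix $\mathbf{H}$ consists of the transpose $\mathbf{H}_s^T$ and all its replicas, each shifted down by $c$ rows with respect to the previous one. Explicitly, the rows of $\mathbf{H}$ are indexed by integers $n\ge 0$, its columns by pairs $(t,i)$ with $t\ge 0$ an integer and $0\le i\le a-1$, and the entry in row $n$ and column $(t,i)$ is $1$ if and only if $0\le n-tc\le L_h-1$ and the entry of $\mathbf{H}_s$ in row $i$, column $n-tc$ is $1$. Here $c=1$. Tanner graph: the bipartite graph whose two vertex classes are the rows and the columns of $\mathbf{H}$, a row being adjacent to a column if and only if the corresponding entry of $\mathbf{H}$ is $1$. A local cycle is a closed walk of positive length in the Tanner graph that starts at a node and returns to it, passing at most once through any edge; its length is its number of edges. *)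

theory Defs
  imports "Jordan_Normal_Form.Matrix" "HOL-Library.Z2"
begin

definition row_weight :: "bit mat \<Rightarrow> nat \<Rightarrow> nat" where
  "row_weight Hs i = card {j. j < dim_col Hs \<and> Hs $$ (i, j) = 1}"

(* The semi-infinite matrix H built from the syndrome former matrix Hs with shift c.
   Rows are all n :: nat; columns are the pairs (t, i) with i < dim_row Hs, and the value
   at other pairs is irrelevant.  The guard t * c \<le> n keeps the subtraction exact. *)
definition parity_check :: "nat \<Rightarrow> bit mat \<Rightarrow> nat \<Rightarrow> nat \<times> nat \<Rightarrow> bit" where
  "parity_check c Hs n = (\<lambda>(t, i).
     if t * c \<le> n \<and> n - t * c < dim_col Hs then Hs $$ (i, n - t * c) else 0)"

datatype tanner_node = Row_Node nat | Col_Node "nat \<times> nat"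

definition tanner_nodes :: "bit mat \<Rightarrow> tanner_node set" where
  "tanner_nodes Hs = range Row_Node \<union> Col_Node ` {(t, i). i < dim_row Hs}"

definition tanner_edges :: "nat \<Rightarrow> bit mat \<Rightarrow> tanner_node set set" where
  "tanner_edges c Hs =
     {{Row_Node n, Col_Node (t, i)} | n t i. i < dim_row Hs \<and> parity_check c Hs n (t, i) = 1}"

(* A walk in an undirected graph is the list of its successive nodes, both end points
   included; a closed walk therefore lists its base point twice. *)
definition walk_edges :: "'v list \<Rightarrow> 'v set list" where
  "walk_edges vs = map (\<lambda>(u, v). {u, v}) (zip vs (tl vs))"

definition walk_length :: "'v list \<Rightarrow> nat" where
  "walk_length vs = length (walk_edges vs)"

definition local_cycle :: "'v set \<Rightarrow> 'v set set \<Rightarrow> 'v list \<Rightarrow> bool" where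
  "local_cycle V E vs \<longleftrightarrow>
     walk_length vs > 0 \<and> hd vs = last vs \<and>
     set vs \<subseteq> V \<and> set (walk_edges vs) \<subseteq> E \<and> distinct (walk_edges vs)"

end

(* A weight-two column of H is an edge of a graph on the rows, joining n and n + d i, where d i is
   the gap between the two ones in row i of Hs.  Local cycles of length 4 and 6 in the Tanner graph
   are the double edges and the triangles of that graph, so their absence says that the gaps are
   distinct and form a sum-free set.  If m is the largest gap, the sets D - {m} and
   {m - x | x in D - {m}} are then disjoint subsets of {1..m-1}, whence 2 (a - 1) <= m - 1 <= Lh - 2.
   Conversely the gaps a, ..., 2 a - 1 are sum-free. *)
theory Submission
  imports Defs
begin

section \<open>Edges and walks of the Tanner graph for shift 1\<close>

lemma tanner_edge_iff [simp]:
  "{Row_Node n, Col_Node (t, i)} \<in> tanner_edges (Suc 0) Hs \<longleftrightarrow>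
     i < dim_row Hs \<and> t \<le> n \<and> n - t < dim_col Hs \<and> Hs $$ (i, n - t) = 1"
  "{Col_Node (t, i), Row_Node n} \<in> tanner_edges (Suc 0) Hs \<longleftrightarrow>
     i < dim_row Hs \<and> t \<le> n \<and> n - t < dim_col Hs \<and> Hs $$ (i, n - t) = 1"
  "{Row_Node n, Row_Node n'} \<notin> tanner_edges c Hs"
  "{Col_Node x, Col_Node y} \<notin> tanner_edges c Hs"
  "{v} \<notin> tanner_edges c Hs"
  by (auto simp: tanner_edges_def parity_check_def doubleton_eq_iff)

lemma tanner_nodes_iff [simp]:
  "Row_Node n \<in> tanner_nodes Hs"
  "Col_Node (t, i) \<in> tanner_nodes Hs \<longleftrightarrow> i < dim_row Hs"
  by (auto simp: tanner_nodes_def)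

lemma walk_edges_simps [simp]:
  "walk_edges [] = []"
  "walk_edges [v] = []"
  "walk_edges (u # v # vs) = {u, v} # walk_edges (v # vs)"
  by (simp_all add: walk_edges_def)

lemma walk_length_eq: "walk_length vs = length vs - 1"
  by (simp add: walk_length_def walk_edges_def)

section \<open>Necessity: short cycles from coinciding gaps and gap sums\<close>

lemma local_cycle_of_equal_gaps:
  assumes "i < dim_row Hs" "j < dim_row Hs" "i \<noteq> j" "d > 0"
    and "p + d < dim_col Hs" "Hs $$ (i, p) = 1" "Hs $$ (i, p + d) = 1"
    and "p' + d < dim_col Hs" "Hs $$ (j, p') = 1" "Hs $$ (j, p' + d) = 1"
  shows "\<exists>vs. local_cycle (tanner_nodes Hs) (tanner_edges 1 Hs) vs \<and> walk_length vs = 4"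
proof -
  \<comment> \<open>Each column is shifted by the first position of the other one, so both start at
    row \<open>?n\<close>; equal gaps then make them end at the same row as well.\<close>
  let ?n = "p + p'"
  let ?vs = "[Row_Node ?n, Col_Node (p', i), Row_Node (?n + d), Col_Node (p, j), Row_Node ?n]"
  have "?n + d - p' = p + d" "?n + d - p = p' + d"
    by auto
  then have "local_cycle (tanner_nodes Hs) (tanner_edges 1 Hs) ?vs"
    using assms by (simp add: local_cycle_def walk_length_eq doubleton_eq_iff)
  then show ?thesis
    by (intro exI[of _ ?vs]) (simp add: walk_length_eq)
qed

text \<open>Gaps \<open>d\<close> and \<open>e\<close> laid end to end span the same rows as
  \<open>d + e\<close>: a triangle on the rows n, n + d, n + d + e. The case \<open>i = j\<close> is
  included because sum-freeness must also exclude x + x.\<close>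

lemma local_cycle_of_gap_sum:
  assumes "i < dim_row Hs" "j < dim_row Hs" "k < dim_row Hs" "d > 0" "e > 0" "k \<noteq> i" "k \<noteq> j"
      "i = j \<Longrightarrow> p = p'"
    and "p + d < dim_col Hs" "Hs $$ (i, p) = 1" "Hs $$ (i, p + d) = 1"
    and "p' + e < dim_col Hs" "Hs $$ (j, p') = 1" "Hs $$ (j, p' + e) = 1"
    and "q + (d + e) < dim_col Hs" "Hs $$ (k, q) = 1" "Hs $$ (k, q + (d + e)) = 1"
  shows "\<exists>vs. local_cycle (tanner_nodes Hs) (tanner_edges 1 Hs) vs \<and> walk_length vs = 6"
proof -
  \<comment> \<open>Adding all three offsets keeps every shift a natural number: the columns of
    \<open>i\<close> and \<open>k\<close> start at row \<open>?n\<close>, that of \<open>j\<close>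
    at \<open>?n + d\<close>.\<close>
  let ?n = "p + p' + q"
  let ?vs = "[Row_Node ?n, Col_Node (p' + q, i), Row_Node (?n + d), Col_Node (p + q + d, j),
              Row_Node (?n + d + e), Col_Node (p + p', k), Row_Node ?n]"
  have "?n - (p' + q) = p" "?n + d - (p' + q) = p + d" "?n + d - (p + q + d) = p'"
    "?n + d + e - (p + q + d) = p' + e" "?n - (p + p') = q" "?n + d + e - (p + p') = q + (d + e)"
    by auto
  \<comment> \<open>The columns of \<open>i\<close> and \<open>j\<close> have shifts
    \<open>p' + q\<close> and \<open>p + q + d\<close>. If \<open>i = j\<close>, they are still
    different columns, since \<open>p = p'\<close> and \<open>d > 0\<close>.\<close>
  moreover have "p' = p + d \<longrightarrow> i \<noteq> j"
    using assms(4,8) by auto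
  ultimately have "local_cycle (tanner_nodes Hs) (tanner_edges 1 Hs) ?vs"
    using assms(1-7,9-) by (simp add: local_cycle_def walk_length_eq doubleton_eq_iff)
  then show ?thesis
    by (intro exI[of _ ?vs]) (simp add: walk_length_eq)
qed

lemma row_weight_two_gap:
  assumes "row_weight Hs i = 2"
  shows "\<exists>p d. d > 0 \<and> p + d < dim_col Hs \<and> Hs $$ (i, p) = 1 \<and> Hs $$ (i, p + d) = 1"
proof -
  obtain x y where xy: "{j. j < dim_col Hs \<and> Hs $$ (i, j) = 1} = {x, y}" "x \<noteq> y"
    using assms by (auto simp: row_weight_def card_2_iff)
  have "x < dim_col Hs" "y < dim_col Hs" "Hs $$ (i, x) = 1" "Hs $$ (i, y) = 1"
    using xy(1) by blast+
  then show ?thesis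
    using xy(2)
    by (cases "x < y") (force intro: exI[of _ x] exI[of _ "y - x"],
        force intro: exI[of _ y] exI[of _ "x - y"])
qed

lemma card_bound_sum_avoiding:
  fixes D :: "nat set"
  assumes "finite D" "D \<noteq> {}" "0 \<notin> D" and sum: "\<And>x y. x \<in> D \<Longrightarrow> y \<in> D \<Longrightarrow> x + y \<noteq> Max D"
  shows "2 * card D \<le> Max D + 1"
proof -
  let ?m = "Max D" and ?r = "\<lambda>x. Max D - x"
  define E where "E = D - {?m}"
  have m: "?m \<in> D"
    using assms by simp
  have E: "finite E" "E \<subseteq> D"
    using assms(1) by (auto simp: E_def)
  have E_range: "\<forall>x\<in>E. 0 < x \<and> x < ?m"
  proof
    fix x assume "x \<in> E"
    then have "x \<in> D" "x \<noteq> ?m"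
      by (auto simp: E_def)
    then show "0 < x \<and> x < ?m"
      using assms(1,3) Max_ge[of D x] by (metis gr0I order_less_le)
  qed
  then have inj: "inj_on ?r E"
    by (intro inj_onI) (metis diff_diff_cancel less_imp_le)
  \<comment> \<open>The hypothesis \<open>sum\<close> covers x = y, so a fixed point of the
    reflection, x = m/2, is excluded too.\<close>
  have "?r x \<notin> E" if "x \<in> E" for x
  proof
    assume "?r x \<in> E"
    moreover have "x + ?r x = ?m"
      using E_range that by (metis le_add_diff_inverse less_imp_le)
    ultimately show False
      using sum that E(2) by (metis subsetD)
  qed
  then have disj: "E \<inter> ?r ` E = {}"
    by auto
  have sub: "E \<union> ?r ` E \<subseteq> {1..<?m}"
    using E_range by (auto simp: Suc_le_eq)
  have "card (E \<union> ?r ` E) = 2 * card E"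
    using E(1) disj inj by (subst card_Un_disjoint) (auto simp: card_image)
  then have "2 * card E \<le> ?m - 1"
    using card_mono[OF _ sub] by simp
  moreover have "card D = Suc (card E)"
    unfolding E_def using assms(1) m by (rule card.remove)
  \<comment> \<open>Without this the truncated subtraction \<open>?m - 1\<close> would not give the
    final bound.\<close>
  moreover have "?m > 0"
    using m assms(3) by (metis gr0I)
  ultimately show ?thesis
    by simp
qed

lemma length_bound_of_girth:
  assumes a: "a > 0" and Hs: "Hs \<in> carrier_mat a Lh" and w: "\<forall>i<a. row_weight Hs i = 2"
    and girth: "\<not> (\<exists>vs. local_cycle (tanner_nodes Hs) (tanner_edges 1 Hs) vs \<and> walk_length vs < 8)"
  shows "2 * a \<le> Lh"
proof -
  have dims: "dim_row Hs = a" "dim_col Hs = Lh"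
    using Hs by auto
  have "\<forall>i. \<exists>p d. i < a \<longrightarrow> d > 0 \<and> p + d < dim_col Hs \<and> Hs $$ (i, p) = 1 \<and> Hs $$ (i, p + d) = 1"
    using w row_weight_two_gap by blast
  then obtain p d where pd: "\<And>i. i < a \<Longrightarrow> d i > 0 \<and> p i + d i < dim_col Hs \<and>
      Hs $$ (i, p i) = 1 \<and> Hs $$ (i, p i + d i) = 1"
    by metis
  let ?D = "d ` {..<a}"
  have inj: "inj_on d {..<a}"
  proof (rule inj_onI, rule ccontr)
    fix i j assume "i \<in> {..<a}" "j \<in> {..<a}" "d i = d j" "i \<noteq> j"
    then have "\<exists>vs. local_cycle (tanner_nodes Hs) (tanner_edges 1 Hs) vs \<and> walk_length vs = 4"
      using pd[of i] pd[of j] dims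
      by (intro local_cycle_of_equal_gaps[where i = i and j = j and d = "d i"
            and p = "p i" and p' = "p j"]) auto
    then show False
      using girth by auto
  qed
  have D: "finite ?D" "?D \<noteq> {}" "0 \<notin> ?D"
    using a pd by fastforce+
  obtain k where k: "k < a" "Max ?D = d k"
    using Max_in[OF D(1,2)] by auto
  have "x + y \<noteq> Max ?D" if xy: "x \<in> ?D" "y \<in> ?D" for x y
  proof
    assume sum: "x + y = Max ?D"
    obtain i j where ij: "i < a" "j < a" "x = d i" "y = d j"
      using xy by auto
    \<comment> \<open>Gaps are positive, so \<open>d k\<close> exceeds both summands and
      \<open>k\<close> is neither of their rows.\<close>
    have dk: "d k = d i + d j" "k \<noteq> i" "k \<noteq> j"
      using sum ij k pd[of i] pd[of j] by auto
    have "\<exists>vs. local_cycle (tanner_nodes Hs) (tanner_edges 1 Hs) vs \<and> walk_length vs = 6"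
      using pd[OF ij(1)] pd[OF ij(2)] pd[OF k(1)] ij k(1) dims dk
      by (intro local_cycle_of_gap_sum[where i = i and j = j and k = k and d = "d i" and e = "d j"
            and p = "p i" and p' = "p j" and q = "p k"]) auto
    then show False
      using girth by auto
  qed
  then have "2 * card ?D \<le> d k + 1"
    using card_bound_sum_avoiding[OF D] k by metis
  \<comment> \<open>By injectivity 2a \<le> \<open>d k + 1\<close>, and
    \<open>p k + d k < Lh\<close> absorbs the 1.\<close>
  then show ?thesis
    using pd[OF k(1)] dims inj by (simp add: card_image)
qed

section \<open>Sufficiency: a matrix with gaps a, ..., 2a - 1 and its girth\<close>

definition interval_gap_mat :: "nat \<Rightarrow> nat \<Rightarrow> bit mat" where
  "interval_gap_mat a Lh = mat a Lh (\<lambda>(i, j). if j = 0 \<or> j = a + i then 1 else 0)"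

lemma interval_gap_mat_carrier: "interval_gap_mat a Lh \<in> carrier_mat a Lh"
  by (simp add: interval_gap_mat_def)

lemma row_weight_interval_gap_mat:
  assumes "i < a" "2 * a \<le> Lh"
  shows "row_weight (interval_gap_mat a Lh) i = 2"
proof -
  \<comment> \<open>The second one lies at column a + i \<le> 2a - 1, which exists because 2a \<le>
    \<open>Lh\<close>.\<close>
  have "{j. j < Lh \<and> interval_gap_mat a Lh $$ (i, j) = 1} = {0, a + i}"
    using assms by (auto simp: interval_gap_mat_def split: if_splits)
  then show ?thesis
    using assms by (simp add: row_weight_def interval_gap_mat_def)
qed

lemma interval_gap_mat_edgeD:
  assumes "{Row_Node n, Col_Node (t, i)} \<in> tanner_edges (Suc 0) (interval_gap_mat a Lh)"
  shows "i < a \<and> (n = t \<or> n = t + a + i)"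
proof -
  have "i < a" "t \<le> n" "n - t = 0 \<or> n - t = a + i"
    using assms by (auto simp: interval_gap_mat_def split: if_splits)
  then show ?thesis
    by linarith
qed

lemma interval_gap_mat_edgeE:
  assumes "{Row_Node n, v} \<in> tanner_edges (Suc 0) (interval_gap_mat a Lh)"
  obtains t i where "v = Col_Node (t, i)" "i < a" "n = t \<or> n = t + a + i"
proof (cases v)
  case (Col_Node x)
  obtain t i where "x = (t, i)"
    by force
  then show ?thesis
    using assms Col_Node that[of t i] interval_gap_mat_edgeD by metis
qed (use assms in auto)

text \<open>A column is determined by its two rows: the smaller one is its shift, and their
  difference a + i gives i. Two distinct columns therefore cannot share two rows.\<close>

lemma interval_gap_mat_no_square:
  fixes a Lh
  defines "E \<equiv> tanner_edges (Suc 0) (interval_gap_mat a Lh)"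
  assumes "{Row_Node n, x1} \<in> E" "{x1, x2} \<in> E" "{x2, x3} \<in> E" "{x3, Row_Node n} \<in> E"
    and "Row_Node n \<noteq> x2" "x1 \<noteq> x3"
  shows False
proof -
  have "{Row_Node n, x3} \<in> E"
    using assms(5) by (simp add: insert_commute)
  then obtain s j where x3: "x3 = Col_Node (s, j)" "n = s \<or> n = s + a + j"
    unfolding E_def by (rule interval_gap_mat_edgeE)
  obtain t i where x1: "x1 = Col_Node (t, i)" "n = t \<or> n = t + a + i"
    using assms(2) unfolding E_def by (rule interval_gap_mat_edgeE)
  obtain m where m: "x2 = Row_Node m"
    using assms(3) x1 by (cases x2) (auto simp: E_def)
  have "m = t \<or> m = t + a + i"
    using interval_gap_mat_edgeD[of m t i a Lh] assms(3) x1 m by (simp add: E_def insert_commute)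
  moreover have "m = s \<or> m = s + a + j"
    using interval_gap_mat_edgeD[of m s j a Lh] assms(4) x3 m by (simp add: E_def insert_commute)
  ultimately show False
    using assms(6,7) x1 x3 m by auto
qed

lemma interval_gap_mat_no_hexagon:
  fixes a Lh
  defines "E \<equiv> tanner_edges (Suc 0) (interval_gap_mat a Lh)"
  assumes "{Row_Node n, x1} \<in> E" "{x1, x2} \<in> E" "{x2, x3} \<in> E" "{x3, x4} \<in> E" "{x4, x5} \<in> E"
      "{x5, Row_Node n} \<in> E"
    and "Row_Node n \<noteq> x2" "x2 \<noteq> x4" "Row_Node n \<noteq> x4"
  shows False
proof -
  obtain t i where x1: "x1 = Col_Node (t, i)" "i < a" "n = t \<or> n = t + a + i"
    using assms(2) unfolding E_def by (rule interval_gap_mat_edgeE)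
  have "{Row_Node n, x5} \<in> E"
    using assms(7) by (simp add: insert_commute)
  then obtain r k where x5: "x5 = Col_Node (r, k)" "k < a" "n = r \<or> n = r + a + k"
    unfolding E_def by (rule interval_gap_mat_edgeE)
  obtain m where m: "x2 = Row_Node m"
    using assms(3) x1 by (cases x2) (auto simp: E_def)
  obtain s j where x3: "x3 = Col_Node (s, j)" "j < a" "m = s \<or> m = s + a + j"
    using assms(4) unfolding E_def m by (rule interval_gap_mat_edgeE)
  obtain l where l: "x4 = Row_Node l"
    using assms(6) x5 by (cases x4) (auto simp: E_def)
  have m_t: "m = t \<or> m = t + a + i"
    using interval_gap_mat_edgeD[of m t i a Lh] assms(3) x1 m by (simp add: E_def insert_commute)
  have l_s: "l = s \<or> l = s + a + j"
    using interval_gap_mat_edgeD[of l s j a Lh] assms(5) x3 l by (simp add: E_def insert_commute)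
  have l_r: "l = r \<or> l = r + a + k"
    using interval_gap_mat_edgeD[of l r k a Lh] assms(6) x5 l by (simp add: E_def insert_commute)
  have nm: "n \<noteq> m" and ml: "m \<noteq> l" and nl: "n \<noteq> l"
    using assms(8-10) m l by auto
  have "n = m + a + i \<or> m = n + a + i"
    using x1(3) nm m_t by auto
  moreover have "m = l + a + j \<or> l = m + a + j"
    using x3(3) ml l_s by auto
  moreover have "n = l + a + k \<or> l = n + a + k"
    using x5(3) nl l_r by auto
  \<comment> \<open>Of the three pairwise differences of n, m, l, the largest is the sum of the
    other two, hence at least 2a; but each difference is less than 2a.\<close>
  ultimately show False
    using x1(2) x3(2) x5(2) by auto
qed

text \<open>Every edge switches between rows and columns. For closed walks this excludes odd
  lengths, so only 2, 4 and 6 remain below 8.\<close>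

lemma tanner_walk_parity:
  assumes "set (walk_edges vs) \<subseteq> tanner_edges (Suc 0) Hs" "vs \<noteq> []"
  shows "(last vs \<in> range Row_Node \<longleftrightarrow> hd vs \<in> range Row_Node) \<longleftrightarrow> even (walk_length vs)"
  using assms
proof (induction vs rule: induct_list012)
  case (3 u v vs)
  have "u \<in> range Row_Node \<longleftrightarrow> v \<notin> range Row_Node"
    using "3.prems" by (cases u; cases v) auto
  then show ?case
    using 3 by (auto simp: walk_length_eq)
qed (auto simp: walk_length_eq)

lemma interval_gap_mat_girth:
  assumes cyc: "local_cycle (tanner_nodes (interval_gap_mat a Lh))
                  (tanner_edges 1 (interval_gap_mat a Lh)) vs"
  shows "walk_length vs \<ge> 8"
proof (rule ccontr)
  let ?E = "tanner_edges (Suc 0) (interval_gap_mat a Lh)"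
  assume "\<not> ?thesis"
  then have short: "walk_length vs < 8"
    by simp
  have walk: "walk_length vs > 0" "hd vs = last vs" "set (walk_edges vs) \<subseteq> ?E"
      "distinct (walk_edges vs)"
    using cyc by (auto simp: local_cycle_def)
  \<comment> \<open>Distinct consecutive edges mean that the walk does not backtrack.\<close>
  have ne: "u \<noteq> w" if "{u, v} \<noteq> {v, w}" for u v w :: tanner_node
    using that by (auto simp: insert_commute)
  have "vs \<noteq> []"
    using walk(1) by (auto simp: walk_length_eq)
  then have "even (walk_length vs)"
    using tanner_walk_parity walk(2,3) by metis
  then obtain h where h: "walk_length vs = 2 * h"
    by blast
  then have "h = 1 \<or> h = 2 \<or> h = 3"
    using walk(1) short by auto
  then consider "length vs = 3" | "length vs = 5" | "length vs = 7"
    using h by (auto simp: walk_length_eq)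
  then show False
  proof cases
    \<comment> \<open>A closed walk of length 2 uses its edge twice.\<close>
    case 1
    then obtain x0 x1 x2 where "vs = [x0, x1, x2]"
      by (auto simp: numeral_eq_Suc length_Suc_conv)
    then show ?thesis
      using walk ne[of x0 x1 x2] by simp
  next
    case 2
    then obtain x0 x1 x2 x3 x4 where vs: "vs = [x0, x1, x2, x3, x4]"
      by (auto simp: numeral_eq_Suc length_Suc_conv)
    have closed: "x4 = x0"
      using walk(2) vs by simp
    have E: "{x0, x1} \<in> ?E" "{x1, x2} \<in> ?E" "{x2, x3} \<in> ?E" "{x3, x0} \<in> ?E"
      using walk(3) vs closed by simp_all
    have "{x0, x1} \<noteq> {x1, x2}" "{x1, x2} \<noteq> {x2, x3}"
      using walk(4) vs closed by simp_all
    note ne = this[THEN ne]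
    show ?thesis
    proof (cases x0)
      case (Row_Node n)
      then show ?thesis
        using interval_gap_mat_no_square[of n x1 a Lh x2 x3] E ne by simp
    \<comment> \<open>Starting the closed walk one node later makes it begin at a row.\<close>
    next
      case (Col_Node c)
      then obtain n where "x1 = Row_Node n"
        using E(1) by (cases x1) auto
      then show ?thesis
        using interval_gap_mat_no_square[of n x2 a Lh x3 x0] E ne by simp
    qed
  next
    case 3
    then obtain x0 x1 x2 x3 x4 x5 x6 where vs: "vs = [x0, x1, x2, x3, x4, x5, x6]"
      by (auto simp: numeral_eq_Suc length_Suc_conv)
    have closed: "x6 = x0"
      using walk(2) vs by simp
    have E: "{x0, x1} \<in> ?E" "{x1, x2} \<in> ?E" "{x2, x3} \<in> ?E" "{x3, x4} \<in> ?E" "{x4, x5} \<in> ?E"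
        "{x5, x0} \<in> ?E"
      using walk(3) vs closed by simp_all
    \<comment> \<open>With the pair of edges at the base point included, \<open>x0\<close>,
      \<open>x2\<close>, \<open>x4\<close> are pairwise distinct and so are \<open>x1\<close>,
      \<open>x3\<close>, \<open>x5\<close>; one of these triples consists of rows.\<close>
    have "{x0, x1} \<noteq> {x1, x2}" "{x1, x2} \<noteq> {x2, x3}" "{x2, x3} \<noteq> {x3, x4}"
        "{x3, x4} \<noteq> {x4, x5}" "{x4, x5} \<noteq> {x5, x0}" "{x0, x1} \<noteq> {x5, x0}"
      using walk(4) vs closed by simp_all
    note ne = this(1-5)[THEN ne] this(6)[THEN not_sym, THEN ne]
    show ?thesis
    proof (cases x0)
      case (Row_Node n)
      then show ?thesis
        using interval_gap_mat_no_hexagon[of n x1 a Lh x2 x3 x4 x5] E ne by simp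
    next
      case (Col_Node c)
      then obtain n where "x1 = Row_Node n"
        using E(1) by (cases x1) auto
      then show ?thesis
        using interval_gap_mat_no_hexagon[of n x2 a Lh x3 x4 x5 x0] E ne by simp
    qed
  qed
qed

theorem mainTheorem2:
  fixes a Lh :: nat
  assumes "a > 1" and "Lh \<ge> 1"
  shows "(\<exists>Hs :: bit mat.
            Hs \<in> carrier_mat a Lh \<and>
            (\<forall>i<a. row_weight Hs i = 2) \<and>
            \<not> (\<exists>vs. local_cycle (tanner_nodes Hs) (tanner_edges 1 Hs) vs \<and> walk_length vs < 8))
         \<longleftrightarrow> Lh \<ge> 2 * a"
proof
  assume "Lh \<ge> 2 * a"
  then show "\<exists>Hs :: bit mat.
            Hs \<in> carrier_mat a Lh \<and>
            (\<forall>i<a. row_weight Hs i = 2) \<and>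
            \<not> (\<exists>vs. local_cycle (tanner_nodes Hs) (tanner_edges 1 Hs) vs \<and> walk_length vs < 8)"
    using interval_gap_mat_carrier row_weight_interval_gap_mat interval_gap_mat_girth
    by (meson linorder_not_less)
qed (use assms length_bound_of_girth in auto)

end
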